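(* Let $n\ge 1$ and let $m_1,\dots,m_n\in\mathbb{R}\setminus\{0\}$ satisfy the No Translation Condition: $\sum_{i\in A} m_i\neq 0$ for every nonempty $A\subseteq\{1,\dots,n\}$. Then there exists a constant $C=C(m_1,\dots,m_n)$ such that for any $T>0$ and any $t_1$, if $(x_1,\dots,x_n)$ is a solution of the point vortex ODE with masses $m_1,\dots,m_n$ on the time interval $[t_1,t_1+T)$, then $$|x_i(s)-x_i(t_1)|<C\sqrt{T}$$ for all $i\in\{1,\dots,n\}$ and all $s\in[t_1,t_1+T)$.
   Context: The point vortex ODE with nonzero real masses $m_1,\dots,m_n$ is the system for $x_i(t)\in\mathbb{R}^2$, $$\frac{d}{dt}x_i(t)=\sum_{j\neq i} m_j K(x_i(t),x_j(t)),\qquad K(x,y)=\frac{(x-y)^\perp}{|x-y|^2},\qquad (z_1,z_2)^\perp=(-z_2,z_1).$$ A solution on a time interval is required to have $x_i(t)\neq x_j(t)$ for all $i\neq j$ and all $t$ in the interval. *)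

theory Defs
  imports "HOL-Analysis.Analysis"
begin

definition perp :: "real^2 \<Rightarrow> real^2" where
  "perp z = vector [- (z $ 2), z $ 1]"

definition vortex_kernel :: "real^2 \<Rightarrow> real^2 \<Rightarrow> real^2" where
  "vortex_kernel x y = perp (x - y) /\<^sub>R (norm (x - y))\<^sup>2"

(* The vortices are x 1, ..., x n; values of m and x at other indices are irrelevant.
   The derivative is taken within the time interval I, so it is one-sided at an
   endpoint belonging to I. *)
definition point_vortex_solution ::
    "nat \<Rightarrow> (nat \<Rightarrow> real) \<Rightarrow> real set \<Rightarrow> (nat \<Rightarrow> real \<Rightarrow> real^2) \<Rightarrow> bool" where
  "point_vortex_solution n m I x \<longleftrightarrow>
     (\<forall>t\<in>I. \<forall>i\<in>{1..n}. \<forall>j\<in>{1..n}. i \<noteq> j \<longrightarrow> x i t \<noteq> x j t) \<and>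
     (\<forall>t\<in>I. \<forall>i\<in>{1..n}.
        (x i has_vector_derivative
           (\<Sum>j\<in>{1..n} - {i}. m j *\<^sub>R vortex_kernel (x i t) (x j t))) (at t within I))"

definition no_translation_condition :: "nat \<Rightarrow> (nat \<Rightarrow> real) \<Rightarrow> bool" where
  "no_translation_condition n m \<longleftrightarrow> (\<forall>A. A \<subseteq> {1..n} \<and> A \<noteq> {} \<longrightarrow> (\<Sum>i\<in>A. m i) \<noteq> 0)"

end

theory Submission
  imports Defs
begin

text \<open>
  The theorem follows from an induction on the number of vortices, provided one admits an external
  force: for a cluster of vortices whose velocities are those of the point vortex system up to an
  error of norm at most \<open>F\<close>, every displacement over a time \<open>T\<close> is at most \<open>C * (sqrt T + F * T)\<close>
  with \<open>C\<close> depending only on the masses (\<open>displacement_bound\<close>).  The theorem is the case \<open>F = 0\<close>.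

  Put \<open>Q = sqrt T + F * T\<close> and fix a length \<open>\<delta>\<close>, a large multiple of \<open>Q\<close>.  There are two
  possibilities.

  \<^item> The diameter of the cluster is of order \<open>\<delta>\<close> at all times.  Mutual interactions cancel in the
    motion of the centre of vorticity, so the centre moves by at most a multiple of \<open>F * T\<close>, and every
    vortex stays within a multiple of \<open>\<delta>\<close> from it.  This is where the No Translation Condition
    enters: the total mass of the cluster, by which one divides, is not zero
    (\<open>weighted_displacement_bound\<close>).

  \<^item> At some time \<open>s\<^sub>0\<close> the cluster has a large diameter, hence splits into two nonempty clusters
    at distance at least \<open>\<delta>\<close> (\<open>separated_subset\<close>).  As long as they are at distance at least
    \<open>\<delta> / 2\<close>, each is a smaller cluster under a force at most \<open>F + O(1 / \<delta>)\<close>, which by induction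
    moves its vortices by a fixed multiple of \<open>Q\<close>, because \<open>T / \<delta>\<close> is at most \<open>Q\<close>.  As \<open>\<delta>\<close> is a
    much larger multiple of \<open>Q\<close>, the separation is never lost, neither before nor after \<open>s\<^sub>0\<close>
    (\<open>separation_persists\<close>), and the induction hypothesis applies on the whole time interval.

  Vortices of one cluster may be arbitrarily close to each other: their interaction enters only
  through its cancellation in the centre of vorticity.  This is why the constant does not depend on
  the configuration.
\<close>

section \<open>The vortex kernel\<close>

lemma norm_perp: "norm (perp z) = norm z"
  by (simp add: norm_vec_def L2_set_def perp_def sum_2 add.commute)

lemma vortex_kernel_self [simp]: "vortex_kernel z z = 0"
  by (simp add: vortex_kernel_def)

lemma vortex_kernel_swap: "vortex_kernel z y = - vortex_kernel y z"
proof -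
  have "perp (z - y) = - perp (y - z)"
    by (simp add: perp_def vec_eq_iff forall_2)
  then show ?thesis
    by (simp add: vortex_kernel_def norm_minus_commute)
qed

lemma norm_vortex_kernel: "norm (vortex_kernel y z) = 1 / norm (y - z)"
  by (simp add: vortex_kernel_def norm_perp power2_eq_square field_simps)

text \<open>Antisymmetry of the kernel makes the centre of vorticity of an isolated system stationary.\<close>

lemma sum_mutual_interactions_eq_0:
  assumes "finite A"
  shows "(\<Sum>i\<in>A. m i *\<^sub>R (\<Sum>j\<in>A - {i}. m j *\<^sub>R vortex_kernel (y i) (y j))) = 0"
    (is "?S = 0")
proof -
  have all: "(\<Sum>j\<in>A - {i}. m j *\<^sub>R vortex_kernel (y i) (y j))
      = (\<Sum>j\<in>A. m j *\<^sub>R vortex_kernel (y i) (y j))" for i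
    using assms by (intro sum.mono_neutral_left) auto
  have S: "?S = (\<Sum>i\<in>A. \<Sum>j\<in>A. (m i * m j) *\<^sub>R vortex_kernel (y i) (y j))"
    by (simp add: all scaleR_sum_right)
  also have "\<dots> = (\<Sum>j\<in>A. \<Sum>i\<in>A. (m i * m j) *\<^sub>R vortex_kernel (y i) (y j))"
    by (rule sum.swap)
  also have "\<dots> = (\<Sum>j\<in>A. \<Sum>i\<in>A. - ((m j * m i) *\<^sub>R vortex_kernel (y j) (y i)))"
    by (intro sum.cong refl, subst vortex_kernel_swap) (simp add: mult.commute)
  also have "\<dots> = - ?S"
    unfolding S by (simp add: sum_negf)
  finally have "2 *\<^sub>R ?S = 0"
    by (simp only: scaleR_2 eq_neg_iff_add_eq_0)
  then show ?thesis
    by (simp only: scaleR_eq_0_iff) simp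
qed

section \<open>Clusters under a bounded external force\<close>

text \<open>
  The external force is quantified separately at each time and vortex: the argument uses only its
  size, so the action of all other vortices can be absorbed into the number \<open>F\<close> without naming them.
\<close>

definition forced_cluster ::
    "('i \<Rightarrow> real) \<Rightarrow> 'i set \<Rightarrow> real set \<Rightarrow> real \<Rightarrow> ('i \<Rightarrow> real \<Rightarrow> real^2) \<Rightarrow> bool" where
  "forced_cluster m A I F x \<longleftrightarrow>
     (\<forall>t\<in>I. \<forall>i\<in>A. \<exists>f. norm f \<le> F \<and>
        (x i has_vector_derivative
           (\<Sum>j\<in>A - {i}. m j *\<^sub>R vortex_kernel (x i t) (x j t)) + f) (at t within I))"

lemma forced_cluster_interval_subset:
  assumes "forced_cluster m A I F x" "J \<subseteq> I"
  shows "forced_cluster m A J F x"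
  using assms unfolding forced_cluster_def
  by (meson has_vector_derivative_within_subset subsetD)

lemma forced_cluster_continuous_on:
  assumes "forced_cluster m A I F x" "i \<in> A"
  shows "continuous_on I (x i)"
  using assms unfolding forced_cluster_def continuous_on_eq_continuous_within
  by (meson has_vector_derivative_continuous)

text \<open>
  The vortices of \<open>A - B\<close> become part of the force on \<open>B\<close>; the kernel has norm at most \<open>1 / d\<close> at
  distance \<open>d\<close> or more, so their contribution is at most \<open>W / d\<close>.
\<close>

lemma forced_cluster_separated_subset:
  assumes cl: "forced_cluster m A I F x" and "finite A" "B \<subseteq> A" and "d > 0"
    and W: "(\<Sum>i\<in>A. \<bar>m i\<bar>) \<le> W"
    and sep: "\<And>t i j. t \<in> I \<Longrightarrow> i \<in> B \<Longrightarrow> j \<in> A - B \<Longrightarrow> d \<le> norm (x i t - x j t)"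
  shows "forced_cluster m B I (F + W / d) x"
  unfolding forced_cluster_def
proof (intro ballI)
  fix t i assume t: "t \<in> I" and i: "i \<in> B"
  let ?v = "\<lambda>j. m j *\<^sub>R vortex_kernel (x i t) (x j t)"
  obtain f where f: "norm f \<le> F"
    and der: "(x i has_vector_derivative (\<Sum>j\<in>A - {i}. ?v j) + f) (at t within I)"
    using cl t i \<open>B \<subseteq> A\<close> unfolding forced_cluster_def by blast
  have "A - {i} = (B - {i}) \<union> (A - B)"
    using i \<open>B \<subseteq> A\<close> by auto
  moreover have "finite B"
    using \<open>finite A\<close> \<open>B \<subseteq> A\<close> by (rule rev_finite_subset)
  ultimately have split: "(\<Sum>j\<in>A - {i}. ?v j) = (\<Sum>j\<in>B - {i}. ?v j) + (\<Sum>j\<in>A - B. ?v j)"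
    using \<open>finite A\<close> by (simp only:) (rule sum.union_disjoint; auto)
  have "norm (\<Sum>j\<in>A - B. ?v j) \<le> (\<Sum>j\<in>A - B. \<bar>m j\<bar> / d)"
  proof (rule sum_norm_le)
    fix j assume "j \<in> A - B"
    then have "1 / norm (x i t - x j t) \<le> 1 / d"
      using sep[OF t i] \<open>d > 0\<close> by (intro divide_left_mono) (auto intro!: mult_pos_pos dest: less_le_trans)
    then have "\<bar>m j\<bar> * (1 / norm (x i t - x j t)) \<le> \<bar>m j\<bar> * (1 / d)"
      by (rule mult_left_mono) simp
    then show "norm (?v j) \<le> \<bar>m j\<bar> / d"
      by (simp add: norm_vortex_kernel)
  qed
  also have "\<dots> \<le> (\<Sum>j\<in>A. \<bar>m j\<bar> / d)"
    using \<open>finite A\<close> \<open>d > 0\<close> by (intro sum_mono2) auto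
  also have "\<dots> \<le> W / d"
    using W \<open>d > 0\<close> by (simp add: sum_divide_distrib[symmetric] divide_right_mono)
  finally have "norm ((\<Sum>j\<in>A - B. ?v j) + f) \<le> F + W / d"
    using f norm_triangle_ineq[of "\<Sum>j\<in>A - B. ?v j" f] by linarith
  then show "\<exists>f. norm f \<le> F + W / d \<and>
      (x i has_vector_derivative (\<Sum>j\<in>B - {i}. ?v j) + f) (at t within I)"
    using der unfolding split add.assoc by blast
qed

text \<open>
  The left-hand side is the total mass times the displacement of the centre of vorticity.  Only the
  external force contributes to its velocity.
\<close>

lemma weighted_displacement_bound:
  assumes cl: "forced_cluster m A {a..b} F x" and "finite A" and "F \<ge> 0"
    and W: "(\<Sum>i\<in>A. \<bar>m i\<bar>) \<le> W"
    and s: "s \<in> {a..b}" and t: "t \<in> {a..b}"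
  shows "norm (\<Sum>i\<in>A. m i *\<^sub>R (x i s - x i t)) \<le> W * F * \<bar>s - t\<bar>"
proof -
  let ?u = "\<lambda>i t. \<Sum>j\<in>A - {i}. m j *\<^sub>R vortex_kernel (x i t) (x j t)"
  obtain f where f: "\<And>t i. t \<in> {a..b} \<Longrightarrow> i \<in> A \<Longrightarrow> norm (f t i) \<le> F"
    and der: "\<And>t i. t \<in> {a..b} \<Longrightarrow> i \<in> A \<Longrightarrow>
      (x i has_vector_derivative ?u i t + f t i) (at t within {a..b})"
  proof -
    have "\<forall>t. \<forall>i. \<exists>f. t \<in> {a..b} \<longrightarrow> i \<in> A \<longrightarrow> norm f \<le> F \<and>
        (x i has_vector_derivative ?u i t + f) (at t within {a..b})"
      using cl unfolding forced_cluster_def by blast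
    then show ?thesis
      using that by (simp only: choice_iff) blast
  qed
  let ?c = "\<lambda>t. \<Sum>i\<in>A. m i *\<^sub>R x i t"
  let ?c' = "\<lambda>t. \<Sum>i\<in>A. m i *\<^sub>R f t i"
  have "norm (?c s - ?c t) \<le> (W * F) * norm (s - t)"
  proof (rule differentiable_bound[where S = "{a..b}" and f' = "\<lambda>t h. h *\<^sub>R ?c' t"])
    fix r assume r: "r \<in> {a..b}"
    have "(?c has_vector_derivative (\<Sum>i\<in>A. m i *\<^sub>R (?u i r + f r i))) (at r within {a..b})"
      by (intro has_vector_derivative_sum bounded_linear.has_vector_derivative[OF bounded_linear_scaleR_right]
          der r)
    also have "(\<Sum>i\<in>A. m i *\<^sub>R (?u i r + f r i)) = ?c' r"
      using sum_mutual_interactions_eq_0[OF \<open>finite A\<close>, of m "\<lambda>i. x i r"]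
      by (simp add: scaleR_add_right sum.distrib)
    finally show "(?c has_derivative (\<lambda>h. h *\<^sub>R ?c' r)) (at r within {a..b})"
      by (simp add: has_vector_derivative_def)
    have "norm (?c' r) \<le> (\<Sum>i\<in>A. \<bar>m i\<bar> * F)"
      by (rule sum_norm_le) (use f r in \<open>auto intro!: mult_left_mono\<close>)
    also have "\<dots> \<le> W * F"
      using W \<open>F \<ge> 0\<close> by (simp add: sum_distrib_right[symmetric] mult_right_mono)
    finally have "norm (?c' r) \<le> W * F" .
    then show "onorm (\<lambda>h. h *\<^sub>R ?c' r) \<le> W * F"
      by (intro onorm_le) (simp add: mult.commute mult_left_mono)
  qed (use s t in auto)
  then show ?thesis
    by (simp add: scaleR_diff_right sum_subtractf)
qed

text \<open>
  Total mass \<open>M\<close> times the displacement of one vortex is the displacement of the weighted sum,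
  corrected by the position relative to the centre at both times.
\<close>

lemma displacement_bound_small_diameter:
  assumes cl: "forced_cluster m A {a..b} F x" and "finite A" and "F \<ge> 0"
    and W: "(\<Sum>i\<in>A. \<bar>m i\<bar>) \<le> W"
    and s: "s \<in> {a..b}" and t: "t \<in> {a..b}" and i: "i \<in> A"
    and diam: "\<And>r i j. r \<in> {a..b} \<Longrightarrow> i \<in> A \<Longrightarrow> j \<in> A \<Longrightarrow> norm (x i r - x j r) \<le> D"
  shows "\<bar>\<Sum>i\<in>A. m i\<bar> * norm (x i s - x i t) \<le> W * (2 * D + F * \<bar>s - t\<bar>)"
proof -
  have "0 \<le> D"
    using diam[OF s i i] by simp
  have relative: "norm (\<Sum>j\<in>A. m j *\<^sub>R (x i r - x j r)) \<le> W * D" if r: "r \<in> {a..b}" for r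
  proof -
    have "norm (\<Sum>j\<in>A. m j *\<^sub>R (x i r - x j r)) \<le> (\<Sum>j\<in>A. \<bar>m j\<bar> * D)"
      by (rule sum_norm_le) (use diam r i in \<open>auto intro!: mult_left_mono\<close>)
    also have "\<dots> \<le> W * D"
      using W \<open>0 \<le> D\<close> by (simp add: sum_distrib_right[symmetric] mult_right_mono)
    finally show ?thesis .
  qed
  have "(\<Sum>j\<in>A. m j) *\<^sub>R (x i s - x i t) = (\<Sum>j\<in>A. m j *\<^sub>R (x i s - x j s))
      - (\<Sum>j\<in>A. m j *\<^sub>R (x i t - x j t)) + (\<Sum>j\<in>A. m j *\<^sub>R (x j s - x j t))"
    by (simp add: scaleR_sum_left sum_subtractf[symmetric] sum.distrib[symmetric] scaleR_diff_right)
  then have "\<bar>\<Sum>j\<in>A. m j\<bar> * norm (x i s - x i t) = norm ((\<Sum>j\<in>A. m j *\<^sub>R (x i s - x j s))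
      - (\<Sum>j\<in>A. m j *\<^sub>R (x i t - x j t)) + (\<Sum>j\<in>A. m j *\<^sub>R (x j s - x j t)))"
    by (metis norm_scaleR)
  also have "\<dots> \<le> norm (\<Sum>j\<in>A. m j *\<^sub>R (x i s - x j s))
      + norm (\<Sum>j\<in>A. m j *\<^sub>R (x i t - x j t)) + norm (\<Sum>j\<in>A. m j *\<^sub>R (x j s - x j t))"
    by (intro norm_triangle_mono norm_triangle_ineq4 order_refl)
  also have "\<dots> \<le> W * D + W * D + W * F * \<bar>s - t\<bar>"
    using relative[OF s] relative[OF t] weighted_displacement_bound[OF cl \<open>finite A\<close> \<open>F \<ge> 0\<close> W s t]
    by linarith
  finally show ?thesis
    by (simp add: algebra_simps)
qed

section \<open>Splitting a cluster and keeping it split\<close>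

text \<open>
  A maximal set reached from \<open>i\<close> by steps shorter than \<open>\<delta>\<close> does the job: it has radius at most
  \<open>card A * \<delta>\<close> around \<open>i\<close>, so it misses \<open>j\<close>.
\<close>

lemma separated_subset:
  fixes y :: "'i \<Rightarrow> 'v::real_normed_vector"
  assumes "finite A" "i \<in> A" "j \<in> A" and "\<delta> \<ge> 0"
    and far: "norm (y i - y j) > real (card A) * \<delta>"
  obtains B where "B \<subset> A" "B \<noteq> {}"
    "\<And>k l. k \<in> B \<Longrightarrow> l \<in> A - B \<Longrightarrow> \<delta> \<le> norm (y k - y l)"
proof -
  let ?near = "\<lambda>B. B \<subseteq> A \<and> i \<in> B \<and> (\<forall>k\<in>B. norm (y i - y k) \<le> real (card B) * \<delta>)"
  have "?near {i}"
    using assms by simp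
  moreover have "\<forall>B. ?near B \<longrightarrow> card B < Suc (card A)"
    using \<open>finite A\<close> by (auto intro: card_mono simp: less_Suc_eq_le)
  ultimately obtain B where B: "?near B" and max: "\<And>B'. ?near B' \<Longrightarrow> card B' \<le> card B"
    using ex_has_greatest_nat[of ?near "{i}" card "Suc (card A)"] by auto
  have fin: "finite B"
    using B \<open>finite A\<close> finite_subset by blast
  have "real (card B) * \<delta> \<le> real (card A) * \<delta>"
    using B \<open>finite A\<close> \<open>\<delta> \<ge> 0\<close> by (intro mult_right_mono) (auto intro: card_mono)
  then have "j \<notin> B"
    using B far by fastforce
  moreover have "\<delta> \<le> norm (y k - y l)" if k: "k \<in> B" and l: "l \<in> A - B" for k l
  proof (rule ccontr)
    assume "\<not> \<delta> \<le> norm (y k - y l)"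
    moreover have "norm (y i - y l) \<le> norm (y i - y k) + norm (y k - y l)"
      using norm_triangle_ineq[of "y i - y k" "y k - y l"] by simp
    moreover have card: "card (insert l B) = Suc (card B)"
      using fin l by simp
    ultimately have "norm (y i - y l) \<le> real (card (insert l B)) * \<delta>"
      using B k by (fastforce simp: distrib_right)
    moreover have "norm (y i - y k') \<le> real (card (insert l B)) * \<delta>" if "k' \<in> B" for k'
      using B that \<open>\<delta> \<ge> 0\<close> unfolding card by (fastforce simp: distrib_right)
    ultimately have "?near (insert l B)"
      using B l by auto
    from max[OF this] show False
      by (simp add: card)
  qed
  ultimately show thesis
    using that[of B] B \<open>j \<in> A\<close> by blast
qed

text \<open>
  A continuity argument in both time directions at once: at the time closest to \<open>s\<^sub>0\<close> at which the
  separation has dropped to \<open>\<delta> / 2\<close>, all points are still within \<open>\<delta> / 4\<close> of their position at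
  time \<open>s\<^sub>0\<close>, a contradiction.
\<close>

lemma separation_persists:
  fixes x :: "'i \<Rightarrow> real \<Rightarrow> 'v::real_normed_vector"
  assumes "finite B" "finite C" and "\<delta> > 0" and s0: "s\<^sub>0 \<in> {a..b}"
    and cont: "\<And>i. i \<in> B \<union> C \<Longrightarrow> continuous_on {a..b} (x i)"
    and sep: "\<And>i j. i \<in> B \<Longrightarrow> j \<in> C \<Longrightarrow> \<delta> \<le> norm (x i s\<^sub>0 - x j s\<^sub>0)"
    and stay: "\<And>t i. t \<in> {a..b} \<Longrightarrow>
      (\<And>r i j. r \<in> {min s\<^sub>0 t..max s\<^sub>0 t} \<Longrightarrow> i \<in> B \<Longrightarrow> j \<in> C \<Longrightarrow> \<delta> / 2 \<le> norm (x i r - x j r)) \<Longrightarrow>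
      i \<in> B \<union> C \<Longrightarrow> norm (x i t - x i s\<^sub>0) < \<delta> / 4"
    and t: "t \<in> {a..b}" and ij: "i \<in> B" "j \<in> C"
  shows "\<delta> / 2 \<le> norm (x i t - x j t)"
proof (rule ccontr)
  assume bad: "\<not> ?thesis"
  define S where "S = (\<Union>i\<in>B. \<Union>j\<in>C. {t \<in> {a..b}. norm (x i t - x j t) \<le> \<delta> / 2})"
  have "closed S"
    unfolding S_def using assms(1,2)
    by (intro closed_UN ballI continuous_on_closed_Collect_le continuous_intros cont) auto
  moreover have "t \<in> S"
    using bad t ij by (force simp: S_def)
  ultimately obtain t' where "t' \<in> S" and closest: "\<And>r. r \<in> S \<Longrightarrow> dist s\<^sub>0 t' \<le> dist s\<^sub>0 r"
    using distance_attains_inf[of S s\<^sub>0] by blast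
  then obtain k l where kl: "k \<in> B" "l \<in> C" and t': "t' \<in> {a..b}"
    and close: "norm (x k t' - x l t') \<le> \<delta> / 2"
    by (auto simp: S_def)
  have "s\<^sub>0 \<noteq> t'"
    using sep[OF kl] close \<open>\<delta> > 0\<close> by auto
  define lo hi where "lo = min s\<^sub>0 t'" and "hi = max s\<^sub>0 t'"
  have lohi: "lo < hi" "{lo..hi} \<subseteq> {a..b}"
    using \<open>s\<^sub>0 \<noteq> t'\<close> s0 t' by (auto simp: lo_def hi_def)
  have separated: "\<delta> / 2 \<le> norm (x i r - x j r)"
    if r: "r \<in> {lo..hi}" and i: "i \<in> B" and j: "j \<in> C" for r i j
  proof (rule continuous_ge_on_closure[where S = "{lo<..<hi}" and f = "\<lambda>r. norm (x i r - x j r)"])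
    show "continuous_on (closure {lo<..<hi}) (\<lambda>r. norm (x i r - x j r))"
      using lohi i j by (auto intro!: continuous_intros intro: continuous_on_subset[OF cont])
    show "r \<in> closure {lo<..<hi}"
      using lohi r by simp
    fix q assume q: "q \<in> {lo<..<hi}"
    then have "dist s\<^sub>0 q < dist s\<^sub>0 t'"
      by (auto simp: lo_def hi_def dist_real_def min_def max_def split: if_splits)
    then have "q \<notin> S"
      using closest by fastforce
    then show "\<delta> / 2 \<le> norm (x i q - x j q)"
      using q lohi i j by (force simp: S_def)
  qed
  have "norm (x k t' - x k s\<^sub>0) < \<delta> / 4" "norm (x l t' - x l s\<^sub>0) < \<delta> / 4"
    using stay[OF t'] separated kl unfolding lo_def hi_def by blast+
  moreover have "dist (x k s\<^sub>0) (x l s\<^sub>0)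
      \<le> dist (x k t') (x k s\<^sub>0) + dist (x k t') (x l t') + dist (x l t') (x l s\<^sub>0)"
    using dist_triangle[of "x k s\<^sub>0" "x l s\<^sub>0" "x l t'"] dist_triangle[of "x k s\<^sub>0" "x l t'" "x k t'"]
    by (simp add: dist_commute)
  ultimately show False
    using sep[OF kl] close unfolding dist_norm by linarith
qed

section \<open>The displacement bound\<close>

text \<open>
  The induction step: either the diameter never exceeds \<open>card A * \<delta>\<close>, where
  \<open>\<delta> = \<kappa> * (sqrt (b - a) + F * (b - a))\<close>, or the cluster splits and \<open>IH\<close> applies to both parts.
  The two summands of the constant belong to the second and to the first case.  A split part moves
  by at most \<open>C * (1 + 2 * W)\<close> in units of \<open>sqrt (b - a) + F * (b - a)\<close>; the choice of \<open>\<kappa>\<close> makes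
  this less than \<open>\<delta> / 4\<close>, so that two parts \<open>\<delta>\<close> apart keep the distance \<open>\<delta> / 2\<close>.
\<close>

lemma displacement_bound_step:
  fixes m :: "'i \<Rightarrow> real" and C W \<kappa> \<mu> :: real
  assumes "finite A" and W: "(\<Sum>i\<in>A. \<bar>m i\<bar>) \<le> W"
    and "\<mu> > 0" and \<mu>: "\<mu> \<le> \<bar>\<Sum>i\<in>A. m i\<bar>"
    and "C \<ge> 0"
    and IH: "\<And>B a b F x s t i. B \<subset> A \<Longrightarrow> a < b \<Longrightarrow> F \<ge> 0 \<Longrightarrow>
      forced_cluster m B {a..b} F x \<Longrightarrow> s \<in> {a..b} \<Longrightarrow> t \<in> {a..b} \<Longrightarrow> i \<in> B \<Longrightarrow>
      norm (x i s - x i t) \<le> C * (sqrt (b - a) + F * (b - a))"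
    and \<kappa>: "\<kappa> = 4 * C * (1 + 2 * W) + 1"
    and "a < b" "F \<ge> 0" and cl: "forced_cluster m A {a..b} F x"
    and s: "s \<in> {a..b}" and t: "t \<in> {a..b}" and i: "i \<in> A"
  shows "norm (x i s - x i t)
    \<le> (C * (1 + 2 * W) + W * (2 * card A * \<kappa> + 1) / \<mu>) * (sqrt (b - a) + F * (b - a))"
proof -
  define Q where "Q = sqrt (b - a) + F * (b - a)"
  define \<delta> where "\<delta> = \<kappa> * Q"
  have "W \<ge> 0"
    using W sum_nonneg[of A "\<lambda>i. \<bar>m i\<bar>"] by linarith
  have "\<kappa> \<ge> 1"
    using \<open>C \<ge> 0\<close> \<open>W \<ge> 0\<close> by (simp add: \<kappa>)
  have "Q > 0" and FQ: "F * (b - a) \<le> Q" and sqrtQ: "sqrt (b - a) \<le> Q"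
    using \<open>a < b\<close> \<open>F \<ge> 0\<close> by (auto simp: Q_def add_pos_nonneg)
  then have "\<delta> > 0"
    using \<open>\<kappa> \<ge> 1\<close> by (simp add: \<delta>_def)
  have "C * (1 + 2 * W) * Q \<ge> 0" and "W * (2 * card A * \<kappa> + 1) / \<mu> * Q \<ge> 0"
    using \<open>C \<ge> 0\<close> \<open>W \<ge> 0\<close> \<open>\<kappa> \<ge> 1\<close> \<open>\<mu> > 0\<close> \<open>Q > 0\<close> by auto
  note nonneg = this
  have "norm (x i s - x i t) \<le> (C * (1 + 2 * W) + W * (2 * card A * \<kappa> + 1) / \<mu>) * Q"
  proof (cases "\<forall>r\<in>{a..b}. \<forall>i\<in>A. \<forall>j\<in>A. norm (x i r - x j r) \<le> card A * \<delta>")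
    case True
    have "\<mu> * norm (x i s - x i t) \<le> \<bar>\<Sum>i\<in>A. m i\<bar> * norm (x i s - x i t)"
      using \<mu> by (intro mult_right_mono) auto
    also have "\<dots> \<le> W * (2 * (card A * \<delta>) + F * \<bar>s - t\<bar>)"
      using True by (intro displacement_bound_small_diameter[OF cl \<open>finite A\<close> \<open>F \<ge> 0\<close> W s t i]) auto
    also have "\<dots> \<le> W * (2 * (card A * \<delta>) + F * (b - a))"
      using \<open>W \<ge> 0\<close> \<open>F \<ge> 0\<close> s t by (intro mult_left_mono add_left_mono) auto
    also have "\<dots> \<le> W * (2 * (card A * \<delta>) + Q)"
      using \<open>W \<ge> 0\<close> FQ by (intro mult_left_mono) auto
    also have "\<dots> = W * (2 * card A * \<kappa> + 1) * Q"
      by (simp add: \<delta>_def algebra_simps)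
    finally have "norm (x i s - x i t) \<le> W * (2 * card A * \<kappa> + 1) / \<mu> * Q"
      using \<open>\<mu> > 0\<close> by (simp add: field_simps)
    then show ?thesis
      using nonneg by (simp add: distrib_right)
  next
    case False
    then obtain s\<^sub>0 i\<^sub>0 j\<^sub>0 where s0: "s\<^sub>0 \<in> {a..b}" and "i\<^sub>0 \<in> A" "j\<^sub>0 \<in> A"
      and "norm (x i\<^sub>0 s\<^sub>0 - x j\<^sub>0 s\<^sub>0) > card A * \<delta>"
      by (auto simp: not_le)
    then obtain B where B: "B \<subset> A" "B \<noteq> {}"
      and sep: "\<And>k l. k \<in> B \<Longrightarrow> l \<in> A - B \<Longrightarrow> \<delta> \<le> norm (x k s\<^sub>0 - x l s\<^sub>0)"
      using separated_subset[of A i\<^sub>0 j\<^sub>0 \<delta> "\<lambda>i. x i s\<^sub>0"] \<open>finite A\<close> \<open>\<delta> > 0\<close> by auto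
    have fin: "finite B" "finite (A - B)"
      using B \<open>finite A\<close> finite_subset[of B A] by auto
    \<comment> \<open>Stated for subintervals, because it both maintains the separation and, once this is known
      to hold throughout, gives the conclusion.\<close>
    have split_bound: "norm (x k u - x k v) \<le> C * (1 + 2 * W) * Q"
      if cd: "c < d" "{c..d} \<subseteq> {a..b}" and u: "u \<in> {c..d}" and v: "v \<in> {c..d}" and k: "k \<in> A"
        and apart: "\<And>r k l. r \<in> {c..d} \<Longrightarrow> k \<in> B \<Longrightarrow> l \<in> A - B \<Longrightarrow> \<delta> / 2 \<le> norm (x k r - x l r)"
      for c d u v k
    proof -
      let ?F = "F + W / (\<delta> / 2)"
      have cl': "forced_cluster m A {c..d} F x"
        by (rule forced_cluster_interval_subset[OF cl cd(2)])
      have parts: "forced_cluster m B {c..d} ?F x" "forced_cluster m (A - B) {c..d} ?F x"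
      proof -
        show "forced_cluster m B {c..d} ?F x"
          using B \<open>\<delta> > 0\<close> apart
          by (intro forced_cluster_separated_subset[OF cl' \<open>finite A\<close> _ _ W]) auto
        have "\<delta> / 2 \<le> norm (x k r - x l r)"
          if "r \<in> {c..d}" "k \<in> A - B" "l \<in> A - (A - B)" for r k l
          using apart[of r l k] that by (simp add: norm_minus_commute)
        then show "forced_cluster m (A - B) {c..d} ?F x"
          using \<open>\<delta> > 0\<close> by (intro forced_cluster_separated_subset[OF cl' \<open>finite A\<close> _ _ W]) auto
      qed
      have F': "?F \<ge> 0"
        using \<open>F \<ge> 0\<close> \<open>W \<ge> 0\<close> \<open>\<delta> > 0\<close> by simp
      have "norm (x k u - x k v) \<le> C * (sqrt (d - c) + ?F * (d - c))"
      proof (cases "k \<in> B")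
        case True
        then show ?thesis
          using IH[OF B(1) cd(1) F' parts(1) u v] by blast
      next
        case False
        then show ?thesis
          using IH[OF _ cd(1) F' parts(2) u v] B k by blast
      qed
      also have "\<dots> \<le> C * (sqrt (b - a) + ?F * (b - a))"
        using cd F' \<open>C \<ge> 0\<close> by (intro mult_left_mono add_mono real_sqrt_le_mono) auto
      also have "\<dots> = C * (Q + 2 * W * ((b - a) / \<delta>))"
        using \<open>\<delta> > 0\<close> by (simp add: Q_def field_simps)
      also have "\<dots> \<le> C * (Q + 2 * W * Q)"
      proof -
        have "b - a = sqrt (b - a) * sqrt (b - a)"
          using \<open>a < b\<close> by simp
        also have "\<dots> \<le> Q * Q"
          using sqrtQ \<open>Q > 0\<close> \<open>a < b\<close> by (intro mult_mono) auto
        \<comment> \<open>The force of the other part lasts for a time \<open>b - a\<close> and has size of order \<open>1 / \<delta>\<close>;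
          its effect is of order \<open>Q\<close> because \<open>\<delta>\<close> and \<open>Q\<close> both dominate \<open>sqrt (b - a)\<close>.\<close>
        also have "\<dots> \<le> Q * \<delta>"
          using \<open>\<kappa> \<ge> 1\<close> \<open>Q > 0\<close> by (simp add: \<delta>_def)
        finally have "(b - a) / \<delta> \<le> Q"
          using \<open>\<delta> > 0\<close> by (simp add: field_simps)
        then show ?thesis
          using \<open>W \<ge> 0\<close> \<open>C \<ge> 0\<close> by (intro mult_left_mono add_left_mono) auto
      qed
      finally show ?thesis
        by (simp add: algebra_simps)
    qed
    have small: "C * (1 + 2 * W) * Q < \<delta> / 4"
      using \<open>Q > 0\<close> by (simp add: \<delta>_def \<kappa> algebra_simps)
    have apart: "\<delta> / 2 \<le> norm (x k r - x l r)"
      if "r \<in> {a..b}" "k \<in> B" "l \<in> A - B" for r k l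
    proof (rule separation_persists[where x = x, OF fin \<open>\<delta> > 0\<close> s0 _ sep _ that])
      show "continuous_on {a..b} (x k)" if "k \<in> B \<union> (A - B)" for k
        using that B by (intro forced_cluster_continuous_on[OF cl]) auto
      fix r k
      assume r: "r \<in> {a..b}" and k: "k \<in> B \<union> (A - B)"
        and until: "\<And>q k l. q \<in> {min s\<^sub>0 r..max s\<^sub>0 r} \<Longrightarrow> k \<in> B \<Longrightarrow> l \<in> A - B \<Longrightarrow>
          \<delta> / 2 \<le> norm (x k q - x l q)"
      show "norm (x k r - x k s\<^sub>0) < \<delta> / 4"
      proof (cases "r = s\<^sub>0")
        case True
        then show ?thesis
          using \<open>\<delta> > 0\<close> by simp
      next
        case False
        then have "norm (x k r - x k s\<^sub>0) \<le> C * (1 + 2 * W) * Q"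
          using r s0 k B until
          by (intro split_bound[of "min s\<^sub>0 r" "max s\<^sub>0 r"]) auto
        then show ?thesis
          using small by linarith
      qed
    qed
    have "norm (x i s - x i t) \<le> C * (1 + 2 * W) * Q"
      using apart by (intro split_bound[OF \<open>a < b\<close> order_refl s t i]) auto
    then show ?thesis
      using nonneg by (simp add: distrib_right)
  qed
  then show ?thesis
    by (simp only: Q_def)
qed

text \<open>
  The induction runs over subsets, as splitting a cluster produces proper subsets of it.  A constant
  valid for all of them at once is the sum of their constants.
\<close>

lemma displacement_bound:
  fixes m :: "'i \<Rightarrow> real"
  assumes "finite V" and nt: "\<And>A. A \<subseteq> V \<Longrightarrow> A \<noteq> {} \<Longrightarrow> (\<Sum>i\<in>A. m i) \<noteq> 0"
  shows "\<exists>C\<ge>0. \<forall>a b F x s t. a < b \<longrightarrow> F \<ge> 0 \<longrightarrow> forced_cluster m V {a..b} F x \<longrightarrow>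
    s \<in> {a..b} \<longrightarrow> t \<in> {a..b} \<longrightarrow>
    (\<forall>i\<in>V. norm (x i s - x i t) \<le> C * (sqrt (b - a) + F * (b - a)))"
    (is "\<exists>C\<ge>0. ?bound C V")
  using assms
proof (induction V rule: finite_psubset_induct)
  case (psubset A)
  show ?case
  proof (cases "A = {}")
    case True
    then show ?thesis by auto
  next
    case False
    have "\<forall>B\<in>{B. B \<subset> A}. \<exists>C. C \<ge> 0 \<and> ?bound C B"
      using psubset.prems by (intro ballI psubset.IH) auto
    from bchoice[OF this] obtain C where C: "\<forall>B\<in>{B. B \<subset> A}. C B \<ge> 0 \<and> ?bound (C B) B"
      by (elim exE)
    then have C0: "C B \<ge> 0" if "B \<subset> A" for B
      using that by simp
    define C\<^sub>0 where "C\<^sub>0 = (\<Sum>B\<in>{B. B \<subset> A}. C B)"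
    define W where "W = (\<Sum>i\<in>A. \<bar>m i\<bar>)"
    define \<mu> where "\<mu> = \<bar>\<Sum>i\<in>A. m i\<bar>"
    define \<kappa> where "\<kappa> = 4 * C\<^sub>0 * (1 + 2 * W) + 1"
    have fin: "finite {B. B \<subset> A}"
      using \<open>finite A\<close> by (auto intro: finite_subset[OF _ finite_Pow_iff[THEN iffD2]])
    have "C\<^sub>0 \<ge> 0"
      unfolding C\<^sub>0_def using C0 by (intro sum_nonneg) auto
    have "\<mu> > 0"
      using psubset.prems[OF order_refl False] by (simp add: \<mu>_def)
    have "W \<ge> 0"
      by (simp add: W_def sum_nonneg)
    have IH: "norm (x i s - x i t) \<le> C\<^sub>0 * (sqrt (b - a) + F * (b - a))"
      if "B \<subset> A" "a < b" "F \<ge> 0" "forced_cluster m B {a..b} F x"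
        "s \<in> {a..b}" "t \<in> {a..b}" "i \<in> B" for B a b F x s t i
    proof -
      have "norm (x i s - x i t) \<le> C B * (sqrt (b - a) + F * (b - a))"
        using C that by blast
      also have "C B \<le> C\<^sub>0"
        unfolding C\<^sub>0_def using that fin C0 by (intro member_le_sum) auto
      finally show ?thesis
        using that by (simp add: mult_right_mono)
    qed
    have "?bound (C\<^sub>0 * (1 + 2 * W) + W * (2 * card A * \<kappa> + 1) / \<mu>) A"
      using IH by (intro allI impI ballI displacement_bound_step[OF \<open>finite A\<close> _ \<open>\<mu> > 0\<close> _ \<open>C\<^sub>0 \<ge> 0\<close> _ \<kappa>_def])
        (auto simp: W_def \<mu>_def)
    moreover have "C\<^sub>0 * (1 + 2 * W) + W * (2 * card A * \<kappa> + 1) / \<mu> \<ge> 0"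
      using \<open>C\<^sub>0 \<ge> 0\<close> \<open>W \<ge> 0\<close> \<open>\<mu> > 0\<close> by (simp add: \<kappa>_def)
    ultimately show ?thesis
      by blast
  qed
qed

theorem theorem6:
  fixes n :: nat and m :: "nat \<Rightarrow> real"
  assumes "n \<ge> 1"
    and "\<forall>i\<in>{1..n}. m i \<noteq> 0"
    and "no_translation_condition n m"
  shows "\<exists>C::real. \<forall>(T::real) (t\<^sub>1::real) (x :: nat \<Rightarrow> real \<Rightarrow> real^2).
           T > 0 \<longrightarrow> point_vortex_solution n m {t\<^sub>1..<t\<^sub>1 + T} x \<longrightarrow>
             (\<forall>i\<in>{1..n}. \<forall>s\<in>{t\<^sub>1..<t\<^sub>1 + T}. norm (x i s - x i t\<^sub>1) < C * sqrt T)"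
proof -
  obtain C where "C \<ge> 0" and C: "\<And>a b F x s t i. a < b \<Longrightarrow> F \<ge> 0 \<Longrightarrow>
      forced_cluster m {1..n} {a..b} F x \<Longrightarrow> s \<in> {a..b} \<Longrightarrow> t \<in> {a..b} \<Longrightarrow> i \<in> {1..n} \<Longrightarrow>
      norm (x i s - x i t) \<le> C * (sqrt (b - a) + F * (b - a))"
    using displacement_bound[of "{1..n}" m] assms(3) unfolding no_translation_condition_def
    by (metis finite_atLeastAtMost)
  \<comment> \<open>The constant \<open>C\<close> itself gives only the weak inequality.\<close>
  have "norm (x i s - x i t\<^sub>1) < (C + 1) * sqrt T"
    if "T > 0" and sol: "point_vortex_solution n m {t\<^sub>1..<t\<^sub>1 + T} x"
      and i: "i \<in> {1..n}" and s: "s \<in> {t\<^sub>1..<t\<^sub>1 + T}" for T t\<^sub>1 x i s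
  proof (cases "s = t\<^sub>1")
    case True
    then show ?thesis
      using \<open>T > 0\<close> \<open>C \<ge> 0\<close> by simp
  next
    case False
    have "forced_cluster m {1..n} {t\<^sub>1..<t\<^sub>1 + T} 0 x"
      using sol by (simp add: forced_cluster_def point_vortex_solution_def)
    then have "forced_cluster m {1..n} {t\<^sub>1..s} 0 x"
      by (rule forced_cluster_interval_subset) (use s in auto)
    then have "norm (x i s - x i t\<^sub>1) \<le> C * (sqrt (s - t\<^sub>1) + 0 * (s - t\<^sub>1))"
      using s i False by (intro C) auto
    also have "\<dots> \<le> C * sqrt T"
      using s \<open>C \<ge> 0\<close> by (auto intro!: mult_left_mono)
    also have "\<dots> < (C + 1) * sqrt T"
      using \<open>T > 0\<close> by simp
    finally show ?thesis .
  qed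
  then show ?thesis
    by blast
qed

end
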